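(* Let $n\geq 2$ be an integer and let $K$ be an infinite field such that $\mathrm{char}(K)\neq 2$. Let $A\in\mathcal{M}_n(K)$. The following conditions are equivalent: (i) $\mathrm{rank}(A)<n/2$. (ii) For every $X\in\mathcal{M}_n(K)$, $\det(AX+XA)=0$.
   Context: $\mathcal{M}_n(K)$ denotes the set of $n\times n$ matrices with entries in $K$. *)

theory Defs
  imports
    "Jordan_Normal_Form.Determinant"
    "Jordan_Normal_Form.DL_Rank"
begin

end

theory Submission
  imports Defs "Jordan_Normal_Form.Char_Poly" "Jordan_Normal_Form.Column_Operations"
begin

text \<open>
  If the rank of $A$ is below $n/2$, then $AX + XA$ has rank below $n$.
  Conversely let the rank be $r \<ge> n/2$. Up to similarity the last $k = n - r \<le> r$ rows of $A$
  vanish, and its upper part $[B\;C]$ has a right inverse. A matrix ring over a field has stable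
  range one: if $PU + QV = 1$, then $P + QY$ is invertible for some $Y$. Applied to $(2B, C)$
  this gives an invertible $2B + CY$; since the field is infinite, $Y$ can be perturbed to a $W$
  that also has full rank $k$. Then $[WC\;WB]$ has a right inverse, too, and a second
  application of stable range provides an invertible Schur complement.
\<close>

section \<open>Matrix products, inverses and determinants\<close>

text \<open>Premises on dimensions instead of carriers leave no size to be guessed, so that the
  simplifier can use this as a rewrite rule towards right-nested products.\<close>

lemma mult_assoc_dims:
  fixes A :: "'a::semiring_0 mat"
  assumes "dim_col A = dim_row B" "dim_col B = dim_row C"
  shows "A * B * C = A * (B * C)"
  using assms by (intro assoc_mult_mat) (auto intro: carrier_matI)

lemma mult_inverse_cancel:
  fixes A :: "'a::semiring_1 mat"
  assumes "A * B = 1\<^sub>m n" "dim_col A = dim_row B" "dim_col B = dim_row C" "dim_row C = n"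
  shows "A * (B * C) = C"
  using assms by (simp flip: mult_assoc_dims)

lemma det_nonzero_inverse:
  fixes A :: "'a::field mat"
  assumes "A \<in> carrier_mat n n" "det A \<noteq> 0"
  obtains B where "B \<in> carrier_mat n n" "A * B = 1\<^sub>m n" "B * A = 1\<^sub>m n"
  \<comment> \<open>The value \<open>undefined\<close> fills the dummy parameter of
    \<open>ring_mat\<close>, on which the units do not depend.\<close>
  using det_non_zero_imp_unit[OF assms, of undefined] unfolding Units_def ring_mat_def by auto

lemma right_inverse_det_nonzero:
  fixes A :: "'a::field mat"
  assumes "A \<in> carrier_mat n n" "B \<in> carrier_mat n n" "A * B = 1\<^sub>m n"
  shows "det A \<noteq> 0"
  using arg_cong[OF assms(3), of det] det_mult[OF assms(1,2)] by auto

section \<open>Partial identities and the rank normal form\<close>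

text \<open>Rectangular shapes are allowed so that the diagonal idempotent with \<open>r\<close>
  ones can be written as \<open>partial_id n r * partial_id r n\<close>. This keeps its
  factorization through dimension \<open>r\<close> visible, which the rank computations
  exploit.\<close>

definition partial_id :: "nat \<Rightarrow> nat \<Rightarrow> 'a::{zero,one} mat" where
  "partial_id n m = mat n m (\<lambda>(i, j). if i = j then 1 else 0)"

lemma partial_id_carrier [simp]: "partial_id n m \<in> carrier_mat n m"
  and partial_id_dims [simp]: "dim_row (partial_id n m) = n" "dim_col (partial_id n m) = m"
  by (auto simp: partial_id_def)

lemma partial_id_mult_index:
  assumes "i < a" "j < b"
  shows "(partial_id a r * partial_id r b :: 'a::semiring_1 mat) $$ (i, j)
    = (if i = j \<and> i < r then 1 else 0)"
proof -
  have "(partial_id a r * partial_id r b :: 'a mat) $$ (i, j)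
      = (\<Sum>l = 0..<r. (if i = l then 1 else 0) * (if l = j then 1 else 0))"
    using assms by (simp add: partial_id_def scalar_prod_def)
  also have "\<dots> = (\<Sum>l = 0..<r. if l = i then (if i = j then 1 else 0) else 0)"
    by (intro sum.cong) auto
  also have "\<dots> = (if i = j \<and> i < r then 1 else 0)"
    by simp
  finally show ?thesis .
qed

lemma partial_id_mult:
  assumes "r \<le> n"
  shows "partial_id r n * partial_id n r = (1\<^sub>m r :: 'a::semiring_1 mat)"
  using assms by (intro eq_matI) (auto simp: partial_id_mult_index simp del: index_mult_mat(1))

lemma partial_id_mult_block:
  "partial_id (r + k) r * partial_id r (r + k)
    = (four_block_mat (1\<^sub>m r) (0\<^sub>m r k) (0\<^sub>m k r) (0\<^sub>m k k) :: 'a::semiring_1 mat)"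
  by (intro eq_matI) (auto simp: partial_id_mult_index simp del: index_mult_mat(1))

lemma bordered_partial_id_mult:
  "four_block_mat (1\<^sub>m 1) (0\<^sub>m 1 n) (0\<^sub>m n 1) (partial_id n r * partial_id r n)
    = (partial_id (Suc n) (Suc r) * partial_id (Suc r) (Suc n) :: 'a::semiring_1 mat)"
  by (intro eq_matI) (auto simp: partial_id_mult_index simp del: index_mult_mat(1))

lemma swaprows_mat_det_nonzero:
  assumes "k < n" "l < n"
  shows "det (swaprows_mat n k l :: 'a::field mat) \<noteq> 0"
  by (rule right_inverse_det_nonzero[OF _ _ swaprows_mat_inv[OF assms]]) auto

text \<open>Gaussian elimination as an induction on \<open>n\<close>: row and column swaps bring a
  nonzero entry to the corner, a block factorization splits it off, and the induction hypothesis
  treats its Schur complement. The zero matrix has \<open>r = 0\<close>.\<close>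

lemma rank_normal_form:
  fixes A :: "'a::field mat"
  assumes "A \<in> carrier_mat n n"
  shows "\<exists>G H r. G \<in> carrier_mat n n \<and> H \<in> carrier_mat n n \<and> det G \<noteq> 0 \<and> det H \<noteq> 0 \<and> r \<le> n
    \<and> A = G * (partial_id n r * partial_id r n) * H"
  using assms
proof (induction n arbitrary: A)
  case 0
  then show ?case
    by (intro exI[of _ "1\<^sub>m 0"] exI[of _ 0]) auto
next
  case (Suc n)
  show ?case
  proof (cases "A = 0\<^sub>m (Suc n) (Suc n)")
    case True
    have "partial_id (Suc n) 0 * partial_id 0 (Suc n) = (0\<^sub>m (Suc n) (Suc n) :: 'a mat)"
      by (intro eq_matI) (auto simp: scalar_prod_def)
    with True show ?thesis
      by (intro exI[of _ "1\<^sub>m (Suc n)"] exI[of _ 0]) auto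
  next
    case False
    then obtain i j where ij: "i < Suc n" "j < Suc n" "A $$ (i, j) \<noteq> 0"
      using Suc.prems by (metis eq_matI carrier_matD index_zero_mat)
    define S where "S = (swaprows_mat (Suc n) 0 i :: 'a mat)"
    define T where "T = (swaprows_mat (Suc n) 0 j :: 'a mat)"
    have ST [simp]: "S \<in> carrier_mat (Suc n) (Suc n)" "T \<in> carrier_mat (Suc n) (Suc n)"
      by (auto simp: S_def T_def)
    have SS: "S * S = 1\<^sub>m (Suc n)" and TT: "T * T = 1\<^sub>m (Suc n)"
      unfolding S_def T_def using ij by (auto intro: swaprows_mat_inv)
    define B where "B = S * A * T"
    have B_swap: "B = swapcols 0 j (swaprows 0 i A)"
      unfolding B_def S_def T_def using ij Suc.prems
      by (subst swapcols_mat[of _ "Suc n" "Suc n"]) (auto simp: swaprows_mat)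
    have B [simp]: "B \<in> carrier_mat (Suc n) (Suc n)"
      using Suc.prems ST by (simp add: B_def mult_carrier_mat[of _ "Suc n" "Suc n"])
    have B00: "B $$ (0, 0) \<noteq> 0"
      unfolding B_swap using ij Suc.prems by auto
    obtain a b c d where split: "split_block B 1 1 = (a, b, c, d)"
      by (metis prod_cases4)
    have abcd: "a \<in> carrier_mat 1 1" "b \<in> carrier_mat 1 n" "c \<in> carrier_mat n 1"
      "d \<in> carrier_mat n n" and B_block: "B = four_block_mat a b c d"
      using split_block[OF split, of n n] B by auto
    have a00: "a $$ (0, 0) \<noteq> 0"
      using B00 abcd unfolding B_block by auto
    have det_a: "det a \<noteq> 0"
      using abcd a00 by (simp add: det_single)
    obtain a' where a': "a' \<in> carrier_mat 1 1" "a * a' = 1\<^sub>m 1" "a' * a = 1\<^sub>m 1"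
      using det_nonzero_inverse[OF abcd(1) det_a] .
    \<comment> \<open>This is the Schur complement of the pivot block \<open>a\<close>.\<close>
    define D where "D = d - c * (a' * b)"
    have D: "D \<in> carrier_mat n n" using abcd a' by (auto simp: D_def)
    obtain G H r where IH: "G \<in> carrier_mat n n" "H \<in> carrier_mat n n" "det G \<noteq> 0" "det H \<noteq> 0"
      "r \<le> n" "D = G * (partial_id n r * partial_id r n) * H"
      using Suc.IH[OF D] by blast
    define border where "border = (\<lambda>M :: 'a mat. four_block_mat (1\<^sub>m 1) (0\<^sub>m 1 n) (0\<^sub>m n 1) M)"
    have border_carrier: "border M \<in> carrier_mat (Suc n) (Suc n)" if "M \<in> carrier_mat n n" for M
      using that four_block_carrier_mat[of "1\<^sub>m 1" 1 1 M n n] by (simp add: border_def)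
    have border_mult: "border M * border N = border (M * N)"
      if "M \<in> carrier_mat n n" "N \<in> carrier_mat n n" for M N
      unfolding border_def using that
      by (subst mult_four_block_mat[of _ 1 1 _ n _ n _ _ 1 _ n])
        (auto intro!: cong_four_block_mat)
    have det_border: "det (border M) = det M" if "M \<in> carrier_mat n n" for M
      unfolding border_def using that
      by (subst det_four_block_mat_lower_left_zero[of _ 1 _ n]) auto
    \<comment> \<open>These are the triangular factors of the block factorization
      \<open>B = L * border D * U\<close>. The pivot \<open>a\<close> is kept in \<open>L\<close>,
      so that the middle factor starts with a plain 1.\<close>
    define L where "L = four_block_mat a (0\<^sub>m 1 n) c (1\<^sub>m n)"
    define U where "U = four_block_mat (1\<^sub>m 1) (a' * b) (0\<^sub>m n 1) (1\<^sub>m n)"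
    have L: "L \<in> carrier_mat (Suc n) (Suc n)" and U: "U \<in> carrier_mat (Suc n) (Suc n)"
      using abcd a' four_block_carrier_mat[of a 1 1 "1\<^sub>m n" n n]
        four_block_carrier_mat[of "1\<^sub>m 1" 1 1 "1\<^sub>m n" n n]
      by (simp_all add: L_def U_def)
    have det_LU: "det L \<noteq> 0" "det U \<noteq> 0"
      unfolding L_def U_def using abcd a' det_a
      by (simp_all add: det_four_block_mat_upper_right_zero[of _ 1 _ n]
          det_four_block_mat_lower_left_zero[of _ 1 _ n])
    have cab: "c * (a' * b) \<in> carrier_mat n n"
      using abcd a' by auto
    have "L * border D = four_block_mat a (0\<^sub>m 1 n) c D"
      unfolding L_def border_def using abcd D
      by (subst mult_four_block_mat[of _ 1 1 _ n _ n _ _ 1 _ n])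
        (auto intro!: cong_four_block_mat)
    then have "L * border D * U = four_block_mat a (a * (a' * b)) c (c * (a' * b) + D)"
      unfolding U_def using abcd D a'
      by (simp, subst mult_four_block_mat[of _ 1 1 _ n _ n _ _ 1 _ n])
        (auto intro!: cong_four_block_mat)
    also have "a * (a' * b) = b"
      using abcd a' by (intro mult_inverse_cancel) auto
    also have "c * (a' * b) + D = d"
      using abcd cab by (intro eq_matI) (auto simp: D_def)
    finally have B_LDU: "B = L * border D * U"
      by (simp add: B_block)
    have "border D = border G * border (partial_id n r * partial_id r n) * border H"
      using IH by (simp add: border_mult mult_carrier_mat[of _ n r])
    also have "border (partial_id n r * partial_id r n)
        = partial_id (Suc n) (Suc r) * partial_id (Suc r) (Suc n)"
      unfolding border_def by (rule bordered_partial_id_mult)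
    finally have D_form: "border D
        = border G * (partial_id (Suc n) (Suc r) * partial_id (Suc r) (Suc n)) * border H" .
    note dims = carrier_matD[OF ST(1)] carrier_matD[OF ST(2)] carrier_matD[OF L] carrier_matD[OF U]
      carrier_matD[OF Suc.prems] carrier_matD[OF border_carrier[OF IH(1)]]
      carrier_matD[OF border_carrier[OF IH(2)]]
    have "A = S * B * T"
      using Suc.prems SS TT
      by (simp add: B_def mult_assoc_dims dims mult_inverse_cancel[OF SS])
    also have "\<dots> = (S * L * border G)
        * (partial_id (Suc n) (Suc r) * partial_id (Suc r) (Suc n)) * (border H * U * T)"
      unfolding B_LDU D_form by (simp add: mult_assoc_dims dims)
    finally have A_form: "A = (S * L * border G)
        * (partial_id (Suc n) (Suc r) * partial_id (Suc r) (Suc n)) * (border H * U * T)" .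
    have "det S \<noteq> 0" "det T \<noteq> 0"
      unfolding S_def T_def using ij by (simp_all add: swaprows_mat_det_nonzero del: One_nat_def)
    then have "det (S * L * border G) \<noteq> 0" "det (border H * U * T) \<noteq> 0"
      using ST L U border_carrier IH det_LU
      by (simp_all add: det_mult[of _ "Suc n"] mult_carrier_mat[of _ "Suc n" "Suc n"] det_border)
    moreover have "S * L * border G \<in> carrier_mat (Suc n) (Suc n)"
      "border H * U * T \<in> carrier_mat (Suc n) (Suc n)"
      using ST L U border_carrier IH
      by (simp_all add: mult_carrier_mat[of _ "Suc n" "Suc n"])
    moreover have "Suc r \<le> Suc n"
      using IH(5) by simp
    ultimately show ?thesis
      using A_form by blast
  qed
qed

section \<open>Stable range one for matrices over a field\<close>

lemma add_minus_cancel_mat: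
  fixes A :: "'a::ab_group_add mat"
  assumes "A \<in> carrier_mat n m" "B \<in> carrier_mat n m"
  shows "A + B - A = B"
  using assms by (intro eq_matI) auto

lemma stable_range:
  fixes P :: "'a::field mat"
  assumes P: "P \<in> carrier_mat m m" and Q: "Q \<in> carrier_mat m p"
    and U: "U \<in> carrier_mat m m" and V: "V \<in> carrier_mat p m"
    and PUQV: "P * U + Q * V = 1\<^sub>m m"
  obtains Y where "Y \<in> carrier_mat p m" "det (P + Q * Y) \<noteq> 0"
proof -
  text \<open>
    Write $P = GJH$ with $J$ idempotent, $F = 1 - J$ and $M = HUG$. For $Y = VGFH$ the hypothesis
    gives $P + QY = G(J + (1 - JM)F)H = G(1 - JMF)H$, and $(JMF)^2 = 0$ because $FJ = 0$.
  \<close>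
  obtain G H r where GH: "G \<in> carrier_mat m m" "H \<in> carrier_mat m m" "det G \<noteq> 0" "det H \<noteq> 0"
    and P_form: "P = G * (partial_id m r * partial_id r m) * H"
    and r: "r \<le> m"
    using rank_normal_form[OF P] by blast
  define J :: "'a mat" where "J = partial_id m r * partial_id r m"
  define F where "F = 1\<^sub>m m - J"
  define M where "M = H * U * G"
  define N where "N = J * M * F"
  have J: "J \<in> carrier_mat m m" unfolding J_def by (rule mult_carrier_mat) auto
  have F: "F \<in> carrier_mat m m" using J unfolding F_def by (intro minus_carrier_mat)
  have M: "M \<in> carrier_mat m m" using GH U by (simp add: M_def mult_carrier_mat[of _ m m])
  have N: "N \<in> carrier_mat m m" using J M F by (simp add: N_def mult_carrier_mat[of _ m m])
  note dims = P[THEN carrier_matD(1)] P[THEN carrier_matD(2)] Q[THEN carrier_matD(1)]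
    Q[THEN carrier_matD(2)] U[THEN carrier_matD(1)] U[THEN carrier_matD(2)]
    V[THEN carrier_matD(1)] V[THEN carrier_matD(2)] GH(1)[THEN carrier_matD(1)]
    GH(1)[THEN carrier_matD(2)] GH(2)[THEN carrier_matD(1)] GH(2)[THEN carrier_matD(2)]
    J[THEN carrier_matD(1)] J[THEN carrier_matD(2)] F[THEN carrier_matD(1)]
    F[THEN carrier_matD(2)] M[THEN carrier_matD(1)] M[THEN carrier_matD(2)]
    N[THEN carrier_matD(1)] N[THEN carrier_matD(2)]
  have "J * J = partial_id m r * ((partial_id r m * partial_id m r) * partial_id r m)"
    unfolding J_def by (simp add: mult_assoc_dims)
  then have JJ: "J * J = J"
    using r by (simp add: partial_id_mult J_def)
  have FJ: "F * J = 0\<^sub>m m m"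
    using J unfolding F_def by (subst minus_mult_distrib_mat[of _ m m]) (auto simp: JJ)
  have "N * N = J * M * ((F * J) * (M * F))"
    unfolding N_def by (simp add: mult_assoc_dims dims)
  then have NN: "N * N = 0\<^sub>m m m"
    using J M F by (simp add: FJ left_mult_zero_mat[of _ m m] mult_carrier_mat[of _ m m]
        right_mult_zero_mat[of _ m m])
  \<comment> \<open>Because \<open>N\<close> squares to zero, the geometric series for the inverse
    of \<open>1 - N\<close> stops after \<open>1 + N\<close>.\<close>
  have "(1\<^sub>m m - N) * (1\<^sub>m m + N) = (1\<^sub>m m + N) - N * (1\<^sub>m m + N)"
    using N by (subst minus_mult_distrib_mat[of _ m m]) auto
  also have "N * (1\<^sub>m m + N) = N"
    using N by (subst mult_add_distrib_mat[of _ m m]) (auto simp: NN)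
  also have "(1\<^sub>m m + N) - N = 1\<^sub>m m"
    using N by (intro eq_matI) auto
  finally have det_N: "det (1\<^sub>m m - N) \<noteq> 0"
    using N by (intro right_inverse_det_nonzero[of _ m "1\<^sub>m m + N"]) auto
  define Y where "Y = V * (G * F * H)"
  have Y: "Y \<in> carrier_mat p m"
    using V GH F by (simp add: Y_def mult_carrier_mat[of _ m m] mult_carrier_mat[of _ p m])
  have "P * U + Q * V - P * U = Q * V"
    using mult_carrier_mat[OF P U] mult_carrier_mat[OF Q V] by (rule add_minus_cancel_mat)
  then have QV: "Q * V = 1\<^sub>m m - P * U"
    by (simp add: PUQV)
  have FN: "F - N \<in> carrier_mat m m"
    using N by (rule minus_carrier_mat)
  have P_GJH: "P = G * (J * H)"
    unfolding P_form J_def using GH by (simp add: mult_assoc_dims)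
  have "Q * Y = (1\<^sub>m m - P * U) * (G * F * H)"
    unfolding Y_def using QV by (simp add: mult_assoc_dims[symmetric] dims)
  also have "\<dots> = G * F * H - P * U * (G * F * H)"
    using P U GH F by (subst minus_mult_distrib_mat[of _ m m])
      (auto simp: mult_carrier_mat[of _ m m])
  \<comment> \<open>After inserting \<open>P = G * (J * H)\<close>, the inner factor
    \<open>H * U * G\<close> is \<open>M\<close>.\<close>
  also have "P * U * (G * F * H) = G * N * H"
    unfolding P_GJH N_def M_def by (simp add: mult_assoc_dims dims)
  finally have "P + Q * Y = G * J * H + (G * F * H - G * N * H)"
    by (simp add: P_GJH mult_assoc_dims dims)
  also have "G * F * H - G * N * H = G * (F - N) * H"
    using GH F N by (simp add: minus_mult_distrib_mat[of _ m m] mult_minus_distrib_mat[of _ m m]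
        mult_carrier_mat[of _ m m])
  also have "G * J * H + G * (F - N) * H = G * (J + (F - N)) * H"
    using GH J FN by (simp add: add_mult_distrib_mat[of _ m m] mult_add_distrib_mat[of _ m m]
        mult_carrier_mat[of _ m m])
  also have "J + (F - N) = 1\<^sub>m m - N"
    using J N by (intro eq_matI) (auto simp: F_def)
  finally have "P + Q * Y = G * (1\<^sub>m m - N) * H" .
  moreover have "1\<^sub>m m - N \<in> carrier_mat m m"
    using N by (rule minus_carrier_mat)
  ultimately have "det (P + Q * Y) \<noteq> 0"
    using GH det_N by (simp add: det_mult[of _ m] mult_carrier_mat[of _ m m])
  with Y that show thesis by blast
qed

section \<open>Finitely many singular parameters\<close>

text \<open>The determinant is a polynomial in \<open>t\<close> whose value at 0 is
  \<open>det M\<close>, so it is not the zero polynomial and has finitely many roots.\<close>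

lemma finite_singular_pencil:
  fixes M N :: "'a::field mat"
  assumes M: "M \<in> carrier_mat n n" and N: "N \<in> carrier_mat n n" and det: "det M \<noteq> 0"
  shows "finite {t. det (M + t \<cdot>\<^sub>m N) = 0}"
proof -
  define p where "p = det (mat n n (\<lambda>(i, j). [:M $$ (i, j), N $$ (i, j):]))"
  have p: "poly p t = det (M + t \<cdot>\<^sub>m N)" for t
    unfolding p_def using M N by (intro poly_det_cong[of _ n]) auto
  have "M + 0 \<cdot>\<^sub>m N = M"
    using M N by (intro eq_matI) auto
  with det have "p \<noteq> 0"
    using p[of 0] by auto
  then show ?thesis
    using poly_roots_finite[of p] by (simp add: p)
qed

text \<open>Here \<open>M\<close> itself may be singular. The determinant is the characteristic
  polynomial of \<open>- M\<close> at \<open>t\<close>, which is nonzero because it is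
  monic.\<close>

lemma finite_singular_shift:
  fixes M :: "'a::field mat"
  assumes "M \<in> carrier_mat n n"
  shows "finite {t. det (M + t \<cdot>\<^sub>m 1\<^sub>m n) = 0}"
proof -
  define p where "p = char_poly (- M)"
  have p: "poly p t = det (M + t \<cdot>\<^sub>m 1\<^sub>m n)" for t
  proof -
    have "- char_matrix (- M) t = M + t \<cdot>\<^sub>m 1\<^sub>m n"
      using assms by (intro eq_matI) (auto simp: char_matrix_def)
    then show ?thesis
      using assms by (simp add: p_def char_poly_matrix[of _ n])
  qed
  have "p \<noteq> 0"
    using degree_monic_char_poly[of "- M" n] assms by (auto simp: p_def)
  then show ?thesis
    using poly_roots_finite[of p] by (simp add: p)
qed

section \<open>Rank estimates\<close>

text \<open>Every column of \<open>A * B\<close> is a combination of columns of \<open>A\<close>, so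
  the column spaces are nested.\<close>

lemma (in vec_space) rank_mult_le:
  assumes A: "A \<in> carrier_mat n m" and B: "B \<in> carrier_mat m l"
  shows "rank (A * B) \<le> rank A"
proof -
  have AB: "A * B \<in> carrier_mat n l" using A B by simp
  have cols_A: "set (cols A) \<subseteq> carrier_vec n" and cols_AB: "set (cols (A * B)) \<subseteq> carrier_vec n"
    using A AB cols_dim[of A] cols_dim[of "A * B"] by simp_all
  have "set (cols (A * B)) \<subseteq> span (set (cols A))"
  proof
    fix x assume "x \<in> set (cols (A * B))"
    then obtain j where j: "j < l" "x = col (A * B) j"
      using AB by (auto simp: cols_def)
    have "x = A *\<^sub>v col B j"
      unfolding j using A B j by (intro col_mult2) auto
    moreover have col_B: "col B j \<in> carrier_vec m"
      using B by auto
    moreover have "A *\<^sub>v col B j \<in> carrier_vec n"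
      using A col_B by (rule mult_mat_vec_carrier)
    ultimately have "x \<in> col_space A"
      unfolding col_space_eq[OF A] using A by auto
    then show "x \<in> span (set (cols A))"
      by (simp add: col_space_def)
  qed
  then have sub: "span (set (cols (A * B))) \<subseteq> span (set (cols A))"
    using span_is_subset span_is_submodule[OF cols_A] by blast
  have S: "VectorSpace.subspace class_ring (span (set (cols A))) V"
    "VectorSpace.subspace class_ring (span (set (cols (A * B)))) V"
    using cols_A cols_AB by (auto intro: span_is_subspace)
  have "VectorSpace.subspace class_ring (span (set (cols (A * B)))) (vs (span (set (cols A))))"
    using nested_subspaces[OF S sub] .
  then show ?thesis
    unfolding rank_def
    using vectorspace.subspace_dim[OF subspace_is_vs[OF S(1)]] fin_dim_span_cols[OF A]
      fin_dim_span_cols[OF AB] by auto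
qed

lemma (in vec_space) rank_left_invertible:
  assumes P: "P \<in> carrier_mat n r" and L: "L \<in> carrier_mat r n" and LP: "L * P = 1\<^sub>m r"
  shows "rank P = r"
proof (rule lin_indpt_full_rank[OF P])
  have inj: "v = 0\<^sub>v r" if "v \<in> carrier_vec r" "P *\<^sub>v v = 0\<^sub>v n" for v
  proof -
    have "v = (L * P) *\<^sub>v v"
      using that LP by simp
    also have "\<dots> = L *\<^sub>v (P *\<^sub>v v)"
      using L P that by (intro assoc_mult_mat_vec) auto
    also have "\<dots> = 0\<^sub>v r"
      using that L by (intro eq_vecI) (auto simp: scalar_prod_def)
    finally show ?thesis .
  qed
  \<comment> \<open>Linear independence concerns the set of columns, which would hide repetitions;
    these have to be excluded separately.\<close>
  show dist: "distinct (cols P)"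
  proof (rule ccontr)
    assume "\<not> distinct (cols P)"
    then obtain i j where ij: "i < r" "j < r" "i \<noteq> j" "col P i = col P j"
      using P by (auto simp: distinct_conv_nth)
    have "col (L * P) i = col (L * P) j"
      using ij L P by (simp add: col_mult2[of _ r n _ r])
    then have "col (1\<^sub>m r :: 'a mat) i $ i = col (1\<^sub>m r) j $ i"
      by (simp add: LP)
    then show False
      using ij by simp
  qed
  show "lin_indpt (set (cols P))"
    using lin_depE[OF P _ dist] inj by metis
qed

text \<open>Identifies the \<open>r\<close> of the normal form as the rank. The matrix is
  \<open>P * Q\<close> with \<open>P\<close> left invertible and \<open>Q\<close> right invertible,
  and \<open>rank_mult_le\<close> gives both inequalities between its rank and that of
  \<open>P\<close>.\<close>

lemma rank_eq_normal_form:
  fixes G :: "'a::field mat"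
  assumes G: "G \<in> carrier_mat n n" and H: "H \<in> carrier_mat n n"
    and det: "det G \<noteq> 0" "det H \<noteq> 0" and r: "r \<le> n"
  shows "vec_space.rank n (G * (partial_id n r * partial_id r n) * H) = r"
proof -
  interpret vec_space "TYPE('a)" n .
  obtain G' where G': "G' \<in> carrier_mat n n" "G' * G = 1\<^sub>m n"
    using det_nonzero_inverse[OF G det(1)] by blast
  obtain H' where H': "H' \<in> carrier_mat n n" "H * H' = 1\<^sub>m n"
    using det_nonzero_inverse[OF H det(2)] by blast
  define P where "P = G * partial_id n r"
  define Q where "Q = partial_id r n * H"
  have P: "P \<in> carrier_mat n r" and Q: "Q \<in> carrier_mat r n"
    using G H by (auto simp: P_def Q_def intro!: mult_carrier_mat[of _ _ n])
  have "partial_id r n * G' * P = partial_id r n * (G' * (G * partial_id n r))"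
    using G G' by (simp add: P_def mult_assoc_dims)
  also have "\<dots> = 1\<^sub>m r"
    using G G' r by (simp add: mult_inverse_cancel partial_id_mult)
  finally have rank_P: "rank P = r"
    using G' by (intro rank_left_invertible[OF P, of "partial_id r n * G'"])
      (auto intro!: mult_carrier_mat[of _ r n])
  have Q_right: "Q * (H' * partial_id n r) = 1\<^sub>m r"
    using H H' r by (simp add: Q_def mult_assoc_dims mult_inverse_cancel partial_id_mult)
  have "P = P * (Q * (H' * partial_id n r))"
    unfolding Q_right using P by simp
  also have "\<dots> = P * Q * (H' * partial_id n r)"
    using P Q H' by (simp add: mult_assoc_dims)
  finally have "rank P \<le> rank (P * Q)"
    using rank_mult_le[of "P * Q" n "H' * partial_id n r" r] P Q H'
    by (simp add: mult_carrier_mat[of _ n r] mult_carrier_mat[of _ n n])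
  moreover have "rank (P * Q) \<le> rank P"
    using rank_mult_le[OF P Q] .
  moreover have "P * Q = G * (partial_id n r * partial_id r n) * H"
    using G H by (simp add: P_def Q_def mult_assoc_dims)
  ultimately show ?thesis
    using rank_P by simp
qed

text \<open>Rank is subadditive, and \<open>rank_mult_le\<close> bounds the rank of
  \<open>A * X\<close>. For \<open>X * A\<close> it only helps after the normal form has provided a
  left factor with \<open>r\<close> columns, where \<open>r\<close> is the rank of
  \<open>A\<close>.\<close>

lemma rank_anticommutator_le:
  fixes A :: "'a::field mat"
  assumes A: "A \<in> carrier_mat n n" and X: "X \<in> carrier_mat n n"
  shows "vec_space.rank n (A * X + X * A) \<le> 2 * vec_space.rank n A"
proof -
  interpret vec_space "TYPE('a)" n .
  obtain G H r where GH: "G \<in> carrier_mat n n" "H \<in> carrier_mat n n" "det G \<noteq> 0" "det H \<noteq> 0"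
    and A_form: "A = G * (partial_id n r * partial_id r n) * H" and r: "r \<le> n"
    using rank_normal_form[OF A] by blast
  have "X * A = X * G * partial_id n r * (partial_id r n * H)"
    unfolding A_form using X GH by (simp add: mult_assoc_dims)
  moreover have "rank (X * G * partial_id n r * (partial_id r n * H))
      \<le> rank (X * G * partial_id n r)"
    using X GH by (intro rank_mult_le[of _ r _ n]) (auto intro!: mult_carrier_mat[of _ _ n])
  moreover have "rank (X * G * partial_id n r) \<le> r"
    using X GH by (intro rank_le_nc) (auto intro!: mult_carrier_mat[of _ _ n])
  moreover have "rank A = r"
    unfolding A_form using GH r by (intro rank_eq_normal_form)
  ultimately have "rank (X * A) \<le> rank A"
    by simp
  moreover have "rank (A * X) \<le> rank A"
    using rank_mult_le[OF A X] .
  moreover have "rank (A * X + X * A) \<le> rank (A * X) + rank (X * A)"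
    using A X by (intro rank_subadditive[of _ n]) auto
  ultimately show ?thesis
    by linarith
qed

section \<open>Construction of an invertible anticommutator\<close>

lemma invertible_anticommutator_block:
  fixes B :: "'k::field mat"
  assumes inf: "infinite (UNIV :: 'k set)" and char: "(2 :: 'k) \<noteq> 0"
    and B: "B \<in> carrier_mat r r" and C: "C \<in> carrier_mat r k" and kr: "k \<le> r"
    and U: "U \<in> carrier_mat r r" and V: "V \<in> carrier_mat k r"
    and BUCV: "B * U + C * V = 1\<^sub>m r"
  defines "A \<equiv> four_block_mat B C (0\<^sub>m k r) (0\<^sub>m k k)"
  shows "\<exists>X \<in> carrier_mat (r + k) (r + k). det (A * X + X * A) \<noteq> 0"
proof -
  text \<open>
    For $X$ with blocks $1, X_2, W, X_4$ the matrix $AX + XA$ has blocks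
    $N = 2B + CW$, $BX_2 + CX_4 + C$, $WB$, $WC$, where the upper right block is arbitrary
    because $BU + CV = 1$. We choose $W$ such that $N$ is invertible and $W$ has rank $k$, and
    the upper right block as $-NT$, so that the Schur complement of $N$ is $WC + WBT$.
  \<close>
  have two_B: "2 \<cdot>\<^sub>m B = B + B"
    using B by (intro eq_matI) auto
  have BU: "B * U \<in> carrier_mat r r" and CV: "C * V \<in> carrier_mat r r"
    using B C U V by auto
  \<comment> \<open>Halving \<open>U\<close> turns the right inverse of the row
    \<open>(B, C)\<close> into one of \<open>(2B, C)\<close>; this is where \<open>2\<close> must be
    nonzero.\<close>
  have "(2 \<cdot>\<^sub>m B) * ((1 / 2) \<cdot>\<^sub>m U) = 2 \<cdot>\<^sub>m ((1 / 2) \<cdot>\<^sub>m (B * U))"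
    by (simp only: mult_smult_assoc_mat[OF B smult_carrier_mat[OF U]] mult_smult_distrib[OF B U])
  also have "\<dots> = B * U"
    using char BU by (intro eq_matI) auto
  finally have "(2 \<cdot>\<^sub>m B) * ((1 / 2) \<cdot>\<^sub>m U) + C * V = 1\<^sub>m r"
    using BUCV by simp
  then obtain Y where Y: "Y \<in> carrier_mat k r" and det_Y: "det (2 \<cdot>\<^sub>m B + C * Y) \<noteq> 0"
    using B C U V by (elim stable_range[rotated -1]) auto
  \<comment> \<open>The direction of the perturbation: \<open>Z\<close> has the right inverse
    \<open>R\<close> since \<open>k \<le> r\<close>, so with \<open>W = Y + t Z\<close> the product
    \<open>W * R\<close> is \<open>Y * R + t\<close>, singular for finitely many \<open>t\<close>
    only.\<close>
  define Z :: "'k mat" where "Z = partial_id k r"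
  define R :: "'k mat" where "R = partial_id r k"
  have Z: "Z \<in> carrier_mat k r" and R: "R \<in> carrier_mat r k" and ZR: "Z * R = 1\<^sub>m k"
    using kr by (simp_all add: Z_def R_def partial_id_mult)
  have "finite ({t. det ((2 \<cdot>\<^sub>m B + C * Y) + t \<cdot>\<^sub>m (C * Z)) = 0} \<union> {t. det (Y * R + t \<cdot>\<^sub>m 1\<^sub>m k) = 0})"
    using finite_singular_pencil[OF _ _ det_Y, of r "C * Z"] finite_singular_shift[of "Y * R" k]
      B C Y Z R by simp
  then obtain t where "t \<notin> {t. det ((2 \<cdot>\<^sub>m B + C * Y) + t \<cdot>\<^sub>m (C * Z)) = 0}
      \<union> {t. det (Y * R + t \<cdot>\<^sub>m 1\<^sub>m k) = 0}"
    using ex_new_if_finite[OF inf] by blast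
  then have t: "det ((2 \<cdot>\<^sub>m B + C * Y) + t \<cdot>\<^sub>m (C * Z)) \<noteq> 0" "det (Y * R + t \<cdot>\<^sub>m 1\<^sub>m k) \<noteq> 0"
    by auto
  define W where "W = Y + t \<cdot>\<^sub>m Z"
  have W: "W \<in> carrier_mat k r"
    using Y Z by (simp add: W_def)
  define N where "N = B + B + C * W"
  have N: "N \<in> carrier_mat r r"
    using B C W by (simp add: N_def)
  have "C * W = C * Y + t \<cdot>\<^sub>m (C * Z)"
    using C Y Z by (simp add: W_def mult_add_distrib_mat[of _ r k] mult_smult_distrib[of _ r k])
  then have "N = (2 \<cdot>\<^sub>m B + C * Y) + t \<cdot>\<^sub>m (C * Z)"
    using B C Y Z by (simp add: N_def two_B assoc_add_mat[of _ r r])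
  with t have det_N: "det N \<noteq> 0"
    by simp
  have WR: "W * R \<in> carrier_mat k k"
    using W R by simp
  have "W * R = Y * R + t \<cdot>\<^sub>m 1\<^sub>m k"
    using Y Z R by (simp add: W_def add_mult_distrib_mat[of _ k r] mult_smult_assoc_mat[of _ k r] ZR)
  with t obtain S where S: "S \<in> carrier_mat k k" "W * R * S = 1\<^sub>m k"
    using det_nonzero_inverse[OF WR] by metis
  note dims = B[THEN carrier_matD(1)] B[THEN carrier_matD(2)] C[THEN carrier_matD(1)]
    C[THEN carrier_matD(2)] U[THEN carrier_matD(1)] U[THEN carrier_matD(2)]
    V[THEN carrier_matD(1)] V[THEN carrier_matD(2)] W[THEN carrier_matD(1)]
    W[THEN carrier_matD(2)] R[THEN carrier_matD(1)] R[THEN carrier_matD(2)]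
    S(1)[THEN carrier_matD(1)] S(1)[THEN carrier_matD(2)]
  have WB: "W * B \<in> carrier_mat k r" and WC: "W * C \<in> carrier_mat k k"
    using W B C by auto
  have RS: "R * S \<in> carrier_mat r k"
    using R S by simp
  \<comment> \<open>The right inverse \<open>R * S\<close> of \<open>W\<close>, pushed through
    \<open>B * U + C * V = 1\<close>, yields the hypothesis of \<open>stable_range\<close> for the
    pair \<open>(W * C, W * B)\<close>.\<close>
  have "(W * C) * (V * (R * S)) + (W * B) * (U * (R * S)) = W * (C * V) * (R * S) + W * (B * U) * (R * S)"
    by (simp add: mult_assoc_dims dims)
  also have "\<dots> = W * (C * V + B * U) * (R * S)"
    using W BU CV RS
    by (simp add: add_mult_distrib_mat[of _ k r] mult_add_distrib_mat[of _ k r] mult_carrier_mat[of _ k r])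
  also have "C * V + B * U = 1\<^sub>m r"
    using B C U V by (simp add: BUCV[symmetric] comm_add_mat[of "C * V" r r])
  also have "W * 1\<^sub>m r * (R * S) = 1\<^sub>m k"
    using W S by (simp add: mult_assoc_dims[symmetric] dims)
  finally obtain T where T: "T \<in> carrier_mat r k" and det_T: "det (W * C + W * B * T) \<noteq> 0"
    using WB WC RS U V by (elim stable_range[rotated -1]) auto
  \<comment> \<open>This is the upper right block wanted in \<open>A * X\<close>;
    \<open>X * A\<close> adds \<open>C\<close> to it, which leaves \<open>- (N * T)\<close>. The
    blocks \<open>U * E\<close> and \<open>V * E\<close> of \<open>X\<close> realize it.\<close>
  define E where "E = - (N * T) - C"
  have E: "E \<in> carrier_mat r k"
    using N T C by (simp add: E_def minus_carrier_mat)
  define X where "X = four_block_mat (1\<^sub>m r) (U * E) W (V * E)"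
  have UE: "U * E \<in> carrier_mat r k" and VE: "V * E \<in> carrier_mat k k"
    using U V E by auto
  have X: "X \<in> carrier_mat (r + k) (r + k)"
    unfolding X_def using VE by (intro four_block_carrier_mat) auto
  have "B * (U * E) + C * (V * E) = (B * U) * E + (C * V) * E"
    using E by (simp add: mult_assoc_dims dims)
  also have "\<dots> = E"
    using E by (simp add: add_mult_distrib_mat[OF BU CV E, symmetric] BUCV)
  finally have E_eq: "B * (U * E) + C * (V * E) = E" .
  have AX: "A * X = four_block_mat (B + C * W) E (0\<^sub>m k r) (0\<^sub>m k k)"
    unfolding A_def X_def using B C W UE VE
    by (subst mult_four_block_mat[of _ r r _ k _ k _ _ r _ k]) (simp_all add: E_eq left_mult_zero_mat[OF UE] left_mult_zero_mat[OF VE])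
  have XA: "X * A = four_block_mat B C (W * B) (W * C)"
    unfolding A_def X_def using B C W UE VE
    by (subst mult_four_block_mat[of _ r r _ k _ k _ _ r _ k])
      (simp_all add: right_mult_zero_mat[OF UE] right_mult_zero_mat[OF VE])
  have "A * X + X * A = four_block_mat (B + C * W + B) (E + C) (0\<^sub>m k r + W * B) (0\<^sub>m k k + W * C)"
    unfolding AX XA using B C W E WB WC by (intro add_four_block_mat) auto
  also have "B + C * W + B = N"
    using B C W unfolding N_def by (intro eq_matI) auto
  also have "E + C = - (N * T)"
    using N T C unfolding E_def by (intro eq_matI) auto
  \<comment> \<open>Splitting off a unipotent factor clears the upper right block and exposes the
    Schur complement of \<open>N\<close> without mentioning the inverse of \<open>N\<close>.\<close>
  also have "four_block_mat N (- (N * T)) (0\<^sub>m k r + W * B) (0\<^sub>m k k + W * C)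
      = four_block_mat N (0\<^sub>m r k) (W * B) (W * C + W * B * T) * four_block_mat (1\<^sub>m r) (- T) (0\<^sub>m k r) (1\<^sub>m k)"
  proof -
    have "- P + (Q + P) = Q" if "P \<in> carrier_mat k k" "Q \<in> carrier_mat k k" for P Q :: "'k mat"
      using that by (intro eq_matI) auto
    then have "W * B * (- T) + (W * C + W * B * T) = W * C"
      using mult_carrier_mat[OF WB T] WC T by (simp add: dims)
    then show ?thesis
      using N T WB WC
      by (subst mult_four_block_mat[of _ r r _ k _ k _ _ r _ k])
        (simp_all add: right_mult_one_mat[OF WB] right_add_zero_mat[OF WB] dims)
  qed
  also have "det \<dots> = det N * det (W * C + W * B * T)"
    using N T WB WC
    by (subst det_mult[of _ "r + k"])
      (simp_all add: det_four_block_mat_upper_right_zero[of _ r _ k]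
        det_four_block_mat_lower_left_zero[of _ r _ k])
  finally show ?thesis
    using X det_N det_T by (intro bexI[of _ X]) auto
qed

text \<open>Conjugating \<open>A = G J H\<close> by \<open>G\<close> gives
  \<open>J * (H * G)\<close>, whose last \<open>n - r\<close> rows vanish. Its upper rows are those
  of the invertible matrix \<open>H * G\<close>, hence have a right inverse, and the block case
  applies.\<close>

lemma invertible_anticommutator_exists:
  fixes A :: "'k::field mat"
  assumes inf: "infinite (UNIV :: 'k set)" and char: "(2 :: 'k) \<noteq> 0"
    and A: "A \<in> carrier_mat n n" and rank: "n \<le> 2 * vec_space.rank n A"
  shows "\<exists>X \<in> carrier_mat n n. det (A * X + X * A) \<noteq> 0"
proof -
  obtain G H r where GH: "G \<in> carrier_mat n n" "H \<in> carrier_mat n n" "det G \<noteq> 0" "det H \<noteq> 0"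
    and A_form: "A = G * (partial_id n r * partial_id r n) * H" and r: "r \<le> n"
    using rank_normal_form[OF A] by blast
  have rank_r: "vec_space.rank n A = r"
    unfolding A_form using GH r by (intro rank_eq_normal_form)
  define k where "k = n - r"
  have n: "n = r + k" and kr: "k \<le> r"
    using r rank rank_r by (auto simp: k_def)
  obtain G' where G': "G' \<in> carrier_mat n n" "G * G' = 1\<^sub>m n" "G' * G = 1\<^sub>m n"
    using det_nonzero_inverse[OF GH(1,3)] .
  have S: "H * G \<in> carrier_mat n n" and det_S: "det (H * G) \<noteq> 0"
    using GH by (simp_all add: det_mult[of _ n])
  obtain S' where S': "S' \<in> carrier_mat n n" "H * G * S' = 1\<^sub>m n"
    using det_nonzero_inverse[OF S det_S] by blast
  obtain B C D E where split: "split_block (H * G) r r = (B, C, D, E)"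
    by (metis prod_cases4)
  obtain U Y V Z where split': "split_block S' r r = (U, Y, V, Z)"
    by (metis prod_cases4)
  have BCDE: "B \<in> carrier_mat r r" "C \<in> carrier_mat r k" "D \<in> carrier_mat k r" "E \<in> carrier_mat k k"
    and S_block: "H * G = four_block_mat B C D E"
    using split_block[OF split, of k k] GH by (auto simp: n)
  have UYVZ: "U \<in> carrier_mat r r" "Y \<in> carrier_mat r k" "V \<in> carrier_mat k r" "Z \<in> carrier_mat k k"
    and S'_block: "S' = four_block_mat U Y V Z"
    using split_block[OF split', of k k] S' by (auto simp: n)
  have "four_block_mat (B * U + C * V) (B * Y + C * Z) (D * U + E * V) (D * Y + E * Z) = 1\<^sub>m n"
    using S'(2) mult_four_block_mat[OF BCDE UYVZ] by (simp add: S_block S'_block)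
  then have entries: "four_block_mat (B * U + C * V) (B * Y + C * Z) (D * U + E * V) (D * Y + E * Z)
      $$ (i, j) = (1\<^sub>m n :: 'k mat) $$ (i, j)" for i j
    by simp
  \<comment> \<open>The upper left block of \<open>H * G * S' = 1\<close>, read off entrywise: the
    first \<open>r\<close> columns of \<open>S'\<close> form the required right inverse.\<close>
  have BUCV: "B * U + C * V = 1\<^sub>m r"
  proof (rule eq_matI)
    fix i j assume ij: "i < dim_row (1\<^sub>m r :: 'k mat)" "j < dim_col (1\<^sub>m r :: 'k mat)"
    have "B * U + C * V \<in> carrier_mat r r" "D * Y + E * Z \<in> carrier_mat k k"
      using BCDE UYVZ by auto
    then have "four_block_mat (B * U + C * V) (B * Y + C * Z) (D * U + E * V) (D * Y + E * Z)
      $$ (i, j) = (B * U + C * V) $$ (i, j)"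
      using ij by (subst index_mat_four_block) auto
    then show "(B * U + C * V) $$ (i, j) = 1\<^sub>m r $$ (i, j)"
      using entries[of i j] ij by (simp add: n)
  qed (use BCDE UYVZ in auto)
  define M where "M = four_block_mat B C (0\<^sub>m k r) (0\<^sub>m k k)"
  have M: "M \<in> carrier_mat n n"
    unfolding M_def n using BCDE by (intro four_block_carrier_mat) auto
  have JS: "partial_id n r * partial_id r n * (H * G) = M"
    unfolding n partial_id_mult_block S_block M_def using BCDE
    by (subst mult_four_block_mat[of _ r r _ k _ k _ _ r _ k])
      (simp_all add: left_mult_zero_mat[OF BCDE(3)] left_mult_zero_mat[OF BCDE(4)]
        left_mult_zero_mat[OF BCDE(1)] left_mult_zero_mat[OF BCDE(2)])
  obtain X where X: "X \<in> carrier_mat n n" and det_X: "det (M * X + X * M) \<noteq> 0"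
    using invertible_anticommutator_block[OF inf char BCDE(1,2) kr UYVZ(1,3) BUCV]
    unfolding M_def n by blast
  note dims = M[THEN carrier_matD(1)] M[THEN carrier_matD(2)] X[THEN carrier_matD(1)]
    X[THEN carrier_matD(2)] GH(1)[THEN carrier_matD(1)] GH(1)[THEN carrier_matD(2)]
    GH(2)[THEN carrier_matD(1)] GH(2)[THEN carrier_matD(2)] G'(1)[THEN carrier_matD(1)]
    G'(1)[THEN carrier_matD(2)]
  have "G * M * G' = A"
    unfolding JS[symmetric] A_form using GH G' by (simp add: mult_assoc_dims dims)
  then have A_conj: "A = G * (M * G')"
    by (simp add: mult_assoc_dims dims)
  \<comment> \<open>Conjugation is multiplicative, so the anticommutator of \<open>A\<close> and
    \<open>X'\<close> is the conjugate of that of \<open>M\<close> and \<open>X\<close>.\<close>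
  define X' where "X' = G * (X * G')"
  have X': "X' \<in> carrier_mat n n"
    using GH X G' by (simp add: X'_def mult_carrier_mat[of _ n n])
  have MX: "M * X \<in> carrier_mat n n" and XM: "X * M \<in> carrier_mat n n"
    using M X by auto
  have "A * X' + X' * A = G * (M * X) * G' + G * (X * M) * G'"
    unfolding A_conj X'_def by (simp add: mult_assoc_dims mult_inverse_cancel[OF G'(3)] dims)
  also have "\<dots> = G * (M * X + X * M) * G'"
    using GH G' MX XM by (simp add: mult_add_distrib_mat[of _ n n] add_mult_distrib_mat[of _ n n]
        mult_carrier_mat[of _ n n])
  finally have "det (A * X' + X' * A) = det G * det (M * X + X * M) * det G'"
    using GH G' MX XM by (simp add: det_mult[of _ n] mult_carrier_mat[of _ n n])
  moreover have "det G' \<noteq> 0"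
    using right_inverse_det_nonzero[OF G'(1) GH(1) G'(3)] .
  ultimately show ?thesis
    using GH det_X X' by (intro bexI[of _ X']) auto
qed

section \<open>The equivalence of the rank condition and singularity\<close>

theorem corollary1:
  fixes n :: nat and A :: "'k::field mat"
  assumes "n \<ge> 2"
    and "infinite (UNIV :: 'k set)"
    and "CHAR('k) \<noteq> 2"
    and "A \<in> carrier_mat n n"
  shows "real (vec_space.rank n A) < real n / 2
    \<longleftrightarrow> (\<forall>X \<in> carrier_mat n n. det (A * X + X * A) = 0)"
proof
  assume "real (vec_space.rank n A) < real n / 2"
  then have "2 * vec_space.rank n A < n"
    by linarith
  then have "vec_space.rank n (A * X + X * A) < n" if "X \<in> carrier_mat n n" for X
    using rank_anticommutator_le[OF assms(4) that] by linarith
  moreover have "A * X + X * A \<in> carrier_mat n n" if "X \<in> carrier_mat n n" for X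
    using assms(4) that by auto
  ultimately show "\<forall>X \<in> carrier_mat n n. det (A * X + X * A) = 0"
    using vec_space.low_rank_det_zero by (metis less_irrefl)
next
  assume singular: "\<forall>X \<in> carrier_mat n n. det (A * X + X * A) = 0"
  \<comment> \<open>A divisor of the prime 2 is 1 or 2, and no field has characteristic 1;
    characteristic 0 is covered since 0 does not divide 2.\<close>
  have "\<not> CHAR('k) dvd 2"
    using assms(3) two_is_prime_nat CHAR_not_1' by (metis One_nat_def prime_nat_iff)
  then have "(2 :: 'k) \<noteq> 0"
    using of_nat_eq_0_iff_char_dvd[of 2, where 'a = 'k] by simp
  then have "\<not> n \<le> 2 * vec_space.rank n A"
    using invertible_anticommutator_exists[OF assms(2) _ assms(4)] singular by blast
  then show "real (vec_space.rank n A) < real n / 2"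
    by linarith
qed

end
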